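(* Let $s\ge1$ and let $b_i,a_{ij}$ ($i,j=1,\dots,s$) be real numbers satisfying $$b_ia_{ij}+b_ja_{ji}=b_ib_j,\qquad \forall\, i,j=1,\dots,s.$$ Let $\tau>0$ and suppose that the vectors $U^n\in\mathbb{R}^N$, $n=0,1,2,\dots$, are generated by the scheme $$\mathcal A_hK_i^n=\mathcal F_h(U^{ni})U^{ni},\qquad U^{ni}=U^n+\tau\sum_{j=1}^sa_{ij}K_j^n,\quad i=1,\dots,s,\qquad U^{n+1}=U^n+\tau\sum_{i=1}^sb_iK_i^n,$$ with $K_i^n,U^{ni}\in\mathbb{R}^N$. Then the scheme conserves the discrete momentum: $$I_h^{n+1}=I_h^n,\qquad I_h^n=\frac12\langle U^n,\mathcal A_hU^n\rangle_h,\qquad n=0,1,2,\dots.$$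
   Context: $\kappa,b,\beta,\delta,\alpha$ are real constants with $\delta>0$, $\alpha>0$ (the constant $b$ is distinct from the Runge-Kutta weights $b_i$); $p$ is a positive integer; $\Omega=[x_l,x_r]$ is a bounded interval. $N$ is an even positive integer, $h=(x_r-x_l)/N$, $\mu=2\pi/(x_r-x_l)$, grid points $x_j=jh$. For $0\le j\le N-1$ let $$l_j(x)=\frac1N\sum_{k=-N/2}^{N/2}\frac1{c_k}e^{\mathrm{i}k\mu(x-x_j)},\qquad c_k=1\text{ if }|k|<N/2,\quad c_k=2\text{ if }|k|=N/2,$$ and define the $N\times N$ (real) Fourier spectral differentiation matrices $D_r$ by $(D_r)_{j,k}=\frac{d^r l_k}{dx^r}(x_j)$, $0\le j,k\le N-1$. Put $\mathcal A_h=I-\delta D_2+\alpha D_4$ ($I$ the identity matrix) and, for $U\in\mathbb{R}^N$, $$\mathcal F_h(U)=-\Big[\kappa D_1+bD_3+\frac{p\beta}{p+1}\big(\mathrm{diag}(U^{p-1})D_1+D_1\,\mathrm{diag}(U^{p-1})\big)\Big].$$ Powers $U^m$ of a vector are taken componentwise ($U^0$ is the all-ones vector), $\mathrm{diag}(V)$ is the diagonal matrix with diagonal $V$, and $\langle U,V\rangle_h=h\sum_{j=0}^{N-1}u_jv_j$. *)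

theory Defs
  imports "HOL-Analysis.Analysis" "Jordan_Normal_Form.Matrix"
begin

(* In the remainder the dollar sign and the bullet belong to vectors of Jordan_Normal_Form. *)
unbundle no vec_syntax
unbundle no inner_syntax

(* Vectors of length N and N x N matrices are indexed by 0, ..., N - 1.  The interval
   [xl, xr] and the even number N of grid cells are parameters throughout. *)

definition mesh :: "real \<Rightarrow> real \<Rightarrow> nat \<Rightarrow> real" where
  "mesh xl xr N = (xr - xl) / real N"

definition wavenum :: "real \<Rightarrow> real \<Rightarrow> real" where
  "wavenum xl xr = 2 * pi / (xr - xl)"

(* The grid is x_j = j h, without an offset xl.  Only the differences x_j - x_k enter the
   differentiation matrices. *)
definition grid :: "real \<Rightarrow> real \<Rightarrow> nat \<Rightarrow> nat \<Rightarrow> real" where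
  "grid xl xr N j = real j * mesh xl xr N"

definition end_weight :: "nat \<Rightarrow> int \<Rightarrow> real" where
  "end_weight N k = (if \<bar>k\<bar> = int (N div 2) then 2 else 1)"

definition trig_basis :: "real \<Rightarrow> real \<Rightarrow> nat \<Rightarrow> nat \<Rightarrow> real \<Rightarrow> complex" where
  "trig_basis xl xr N j x =
     1 / of_nat N * (\<Sum>k = - int (N div 2) .. int (N div 2).
       1 / of_real (end_weight N k) *
       exp (\<i> * of_int k * of_real (wavenum xl xr * (x - grid xl xr N j))))"

definition nth_vector_derivative ::
    "nat \<Rightarrow> (real \<Rightarrow> 'a::real_normed_vector) \<Rightarrow> real \<Rightarrow> 'a" where
  "nth_vector_derivative r f = ((\<lambda>g x. vector_derivative g (at x)) ^^ r) f"

(* The entries are real numbers, so that Re only changes the type: see diff_mat_entry. *)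
definition diff_mat :: "real \<Rightarrow> real \<Rightarrow> nat \<Rightarrow> nat \<Rightarrow> real mat" where
  "diff_mat xl xr N r =
     mat N N (\<lambda>(j, k). Re (nth_vector_derivative r (trig_basis xl xr N k) (grid xl xr N j)))"

definition A_op :: "real \<Rightarrow> real \<Rightarrow> nat \<Rightarrow> real \<Rightarrow> real \<Rightarrow> real mat" where
  "A_op xl xr N \<delta> \<alpha> =
     1\<^sub>m N - \<delta> \<cdot>\<^sub>m diff_mat xl xr N 2 + \<alpha> \<cdot>\<^sub>m diff_mat xl xr N 4"

definition diag_pow :: "nat \<Rightarrow> real vec \<Rightarrow> nat \<Rightarrow> real mat" where
  "diag_pow N U m = mat_diag N (\<lambda>i. (U $ i) ^ m)"

definition F_op ::
    "real \<Rightarrow> real \<Rightarrow> nat \<Rightarrow> real \<Rightarrow> real \<Rightarrow> real \<Rightarrow> nat \<Rightarrow> real vec \<Rightarrow> real mat" where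
  "F_op xl xr N \<kappa> b \<beta> p U =
     - (\<kappa> \<cdot>\<^sub>m diff_mat xl xr N 1 + b \<cdot>\<^sub>m diff_mat xl xr N 3
        + (real p * \<beta> / (real p + 1)) \<cdot>\<^sub>m
            (diag_pow N U (p - 1) * diff_mat xl xr N 1
             + diff_mat xl xr N 1 * diag_pow N U (p - 1)))"

definition inner_h :: "real \<Rightarrow> real \<Rightarrow> nat \<Rightarrow> real vec \<Rightarrow> real vec \<Rightarrow> real" where
  "inner_h xl xr N U V = mesh xl xr N * (\<Sum>j<N. U $ j * V $ j)"

definition momentum :: "real \<Rightarrow> real \<Rightarrow> nat \<Rightarrow> real \<Rightarrow> real \<Rightarrow> real vec \<Rightarrow> real" where
  "momentum xl xr N \<delta> \<alpha> U = 1 / 2 * inner_h xl xr N U (A_op xl xr N \<delta> \<alpha> *\<^sub>v U)"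

lemma nth_vector_derivative_trig_basis:
  "nth_vector_derivative r (trig_basis xl xr N j) = (\<lambda>x.
     1 / of_nat N * (\<Sum>k = - int (N div 2) .. int (N div 2).
       1 / of_real (end_weight N k) * (\<i> * of_int k * of_real (wavenum xl xr)) ^ r *
       exp (\<i> * of_int k * of_real (wavenum xl xr * (x - grid xl xr N j)))))"
proof (induction r)
  case 0
  show ?case by (simp add: nth_vector_derivative_def trig_basis_def fun_eq_iff)
next
  case (Suc r)
  let ?w = "\<lambda>k. \<i> * of_int k * of_real (wavenum xl xr) :: complex"
  have e: "((\<lambda>x. exp (\<i> * of_int k * of_real (wavenum xl xr * (x - grid xl xr N j))))
      has_vector_derivative
        ?w k * exp (\<i> * of_int k * of_real (wavenum xl xr * (x - grid xl xr N j)))) (at x)"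
    for k :: int and x
  proof -
    have "((\<lambda>z. exp (?w k * (z - of_real (grid xl xr N j)))) has_field_derivative
        ?w k * exp (?w k * (of_real x - of_real (grid xl xr N j)))) (at (of_real x))"
      by (auto intro!: derivative_eq_intros)
    from has_vector_derivative_real_field[OF this] show ?thesis
      by (simp add: mult.assoc)
  qed
  have m: "c * ?w k ^ Suc r * z = c * ?w k ^ r * (?w k * z)" for c z k
    by (simp add: mult_ac)
  show ?case
    unfolding nth_vector_derivative_def funpow.simps comp_def
    unfolding nth_vector_derivative_def[symmetric] Suc.IH m
    by (intro ext vector_derivative_at has_vector_derivative_mult_right
        has_vector_derivative_sum e)
qed

lemma diff_mat_entry:
  assumes "j < N" and "k < N"
  shows "complex_of_real (diff_mat xl xr N r $$ (j, k)) =
    nth_vector_derivative r (trig_basis xl xr N k) (grid xl xr N j)"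
proof -
  let ?d = "nth_vector_derivative r (trig_basis xl xr N k) (grid xl xr N j)"
  have "cnj ?d = ?d"
    unfolding nth_vector_derivative_trig_basis complex_cnj_mult cnj_sum
    by (rule arg_cong2[where f = "(*)"], simp,
        rule sum.reindex_bij_witness[of _ uminus uminus])
      (auto simp: end_weight_def exp_cnj)
  then show ?thesis
    using assms by (simp add: diff_mat_def complex_eq_iff)
qed

end

theory Submission
  imports Defs
begin

text \<open>
  The scheme is a Runge-Kutta method for \<open>A u' = F(u) u\<close>, where \<open>A\<close> is symmetric and every
  \<open>F(u)\<close> is skew-symmetric. Hence the quadratic form \<open>u \<bullet> A u\<close> is a first integral of the
  differential equation: its derivative is \<open>2 u \<bullet> A u' = 2 u \<bullet> F(u) u = 0\<close>.

  Symmetry and skew-symmetry come from the parity of the differentiation matrices. The entry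
  \<open>(j, k)\<close> of \<open>D\<^sub>r\<close> is a value of the \<open>r\<close>-th derivative of one and the same even function at
  \<open>x\<^sub>j - x\<^sub>k\<close>, so exchanging \<open>j\<close> and \<open>k\<close> multiplies it by \<open>(-1)\<^sup>r\<close>
  (\<open>transpose_diff_mat\<close>). Therefore \<open>A\<close>, built from the identity and even derivatives, is
  symmetric, and \<open>F(u)\<close> is skew-symmetric because the product of a diagonal matrix with \<open>D\<^sub>1\<close>
  enters it symmetrized.

  The condition on the coefficients is Cooper's condition, under which a Runge-Kutta method
  conserves the quadratic first integrals of an equation (\<open>Runge_Kutta_conserves_quadratic_form\<close>). The
  increment of the form over one step consists of a part linear in the stage slopes \<open>k\<^sub>i\<close> and a
  part quadratic in them. Orthogonality of \<open>A k\<^sub>i\<close> to the \<open>i\<close>-th stage turns the linear part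
  into a quadratic one with coefficients \<open>-(b\<^sub>i a\<^sub>i\<^sub>j + b\<^sub>j a\<^sub>j\<^sub>i)\<close>, and
  the condition says that the two parts cancel.
\<close>

section \<open>Parity of the differentiation matrices\<close>

lemma diff_mat_carrier [simp]: "diff_mat xl xr N r \<in> carrier_mat N N"
  by (simp add: diff_mat_def)

text \<open>
  The spectrum of a basis function is symmetric about zero, so the substitution \<open>m \<mapsto> -m\<close> of the
  frequency compensates the exchange of the two grid points, except for the factor
  \<open>(-1)\<^sup>r\<close> left by \<open>(\<i> m \<mu>)\<^sup>r\<close>.
\<close>

lemma diff_mat_parity:
  assumes "j < N" and "k < N"
  shows "diff_mat xl xr N r $$ (k, j) = (- 1) ^ r * diff_mat xl xr N r $$ (j, k)"
proof -
  let ?w = "\<lambda>m::int. \<i> * of_int m * of_real (wavenum xl xr) :: complex"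
  let ?e = "\<lambda>m x y. exp (\<i> * of_int m * of_real (wavenum xl xr * (x - y))) :: complex"
  let ?c = "\<lambda>m. 1 / of_real (end_weight N m) :: complex"
  let ?M = "int (N div 2)" and ?x = "grid xl xr N"
  have "(\<Sum>m = - ?M .. ?M. ?c m * ?w m ^ r * ?e m (?x k) (?x j)) =
      (\<Sum>m = - ?M .. ?M. ?c (- m) * ?w (- m) ^ r * ?e (- m) (?x k) (?x j))"
    by (rule sum.reindex_bij_witness[of _ uminus uminus]) auto
  also have "\<dots> = (\<Sum>m = - ?M .. ?M. (- 1) ^ r * (?c m * ?w m ^ r * ?e m (?x j) (?x k)))"
  proof (rule sum.cong[OF refl])
    fix m :: int
    have "?c (- m) = ?c m"
      by (simp add: end_weight_def)
    moreover have "?w (- m) ^ r = (- 1) ^ r * ?w m ^ r"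
      by (simp flip: power_mult_distrib)
    moreover have "?e (- m) (?x k) (?x j) = ?e m (?x j) (?x k)"
      by (simp add: algebra_simps)
    ultimately show "?c (- m) * ?w (- m) ^ r * ?e (- m) (?x k) (?x j) =
        (- 1) ^ r * (?c m * ?w m ^ r * ?e m (?x j) (?x k))"
      by simp
  qed
  also have "\<dots> = (- 1) ^ r * (\<Sum>m = - ?M .. ?M. ?c m * ?w m ^ r * ?e m (?x j) (?x k))"
    by (rule sum_distrib_left[symmetric])
  finally have "complex_of_real (diff_mat xl xr N r $$ (k, j)) =
      (- 1) ^ r * complex_of_real (diff_mat xl xr N r $$ (j, k))"
    using assms by (simp add: diff_mat_entry nth_vector_derivative_trig_basis)
  then have "complex_of_real (diff_mat xl xr N r $$ (k, j)) =
      complex_of_real ((- 1) ^ r * diff_mat xl xr N r $$ (j, k))"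
    by simp
  then show ?thesis
    by (simp only: of_real_eq_iff)
qed

lemma transpose_diff_mat:
  "(diff_mat xl xr N r)\<^sup>T = (- 1) ^ r \<cdot>\<^sub>m diff_mat xl xr N r"
proof (rule eq_matI)
  fix j k
  assume "j < dim_row ((- 1) ^ r \<cdot>\<^sub>m diff_mat xl xr N r)"
    and "k < dim_col ((- 1) ^ r \<cdot>\<^sub>m diff_mat xl xr N r)"
  then have "j < N" "k < N"
    by (simp_all add: diff_mat_def)
  moreover have "dim_row (diff_mat xl xr N r) = N" "dim_col (diff_mat xl xr N r) = N"
    by (simp_all add: diff_mat_def)
  ultimately show "(diff_mat xl xr N r)\<^sup>T $$ (j, k) = ((- 1) ^ r \<cdot>\<^sub>m diff_mat xl xr N r) $$ (j, k)"
    by (simp add: diff_mat_parity[of j N k])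
qed (simp_all add: diff_mat_def)

section \<open>Symmetry of the two operators of the scheme\<close>

lemma A_op_carrier [simp]: "A_op xl xr N \<delta> \<alpha> \<in> carrier_mat N N"
  by (simp add: A_op_def)

lemma diag_pow_carrier [simp]: "diag_pow N U m \<in> carrier_mat N N"
  by (simp add: diag_pow_def)

lemma F_op_carrier [simp]: "F_op xl xr N \<kappa> b \<beta> p U \<in> carrier_mat N N"
  by (simp add: F_op_def mult_carrier_mat[of _ N N])

lemma transpose_smult_mat: "(c \<cdot>\<^sub>m A)\<^sup>T = c \<cdot>\<^sub>m A\<^sup>T"
  by (rule eq_matI) auto

lemma transpose_diag_pow: "(diag_pow N U m)\<^sup>T = diag_pow N U m"
  by (rule eq_matI) (auto simp: diag_pow_def mat_diag_def)

lemma A_op_symmetric: "(A_op xl xr N \<delta> \<alpha>)\<^sup>T = A_op xl xr N \<delta> \<alpha>"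
proof -
  let ?D = "diff_mat xl xr N"
  have even: "(?D r)\<^sup>T = ?D r" if "even r" for r
    using that by (intro eq_matI) (simp_all add: transpose_diff_mat)
  have "(A_op xl xr N \<delta> \<alpha>)\<^sup>T = (1\<^sub>m N)\<^sup>T - (\<delta> \<cdot>\<^sub>m ?D 2)\<^sup>T + (\<alpha> \<cdot>\<^sub>m ?D 4)\<^sup>T"
    unfolding A_op_def by (simp add: transpose_add[of _ N N] transpose_minus[of _ N N]
        minus_carrier_mat)
  then show ?thesis
    by (simp add: A_op_def transpose_smult_mat even)
qed

lemma F_op_skew_symmetric: "(F_op xl xr N \<kappa> b \<beta> p U)\<^sup>T = - F_op xl xr N \<kappa> b \<beta> p U"
proof -
  let ?D = "diff_mat xl xr N" and ?P = "diag_pow N U (p - 1)"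
  let ?c = "real p * \<beta> / (real p + 1)"
  have odd: "(?D r)\<^sup>T = - ?D r" if "odd r" for r
    using that by (intro eq_matI) (simp_all add: transpose_diff_mat)
  have products: "(?P * ?D 1)\<^sup>T = - (?D 1 * ?P)" "(?D 1 * ?P)\<^sup>T = - (?P * ?D 1)"
    using carrier_matD[OF diff_mat_carrier, of xl xr N] carrier_matD[OF diag_pow_carrier, of N U]
    by (simp_all add: transpose_mult[of _ N N _ N] odd transpose_diag_pow)
  have carriers: "?P * ?D 1 \<in> carrier_mat N N" "?D 1 * ?P \<in> carrier_mat N N"
    by (simp_all add: mult_carrier_mat[of _ N N])
  have negation: "\<kappa> \<cdot>\<^sub>m - X + b \<cdot>\<^sub>m - Y + ?c \<cdot>\<^sub>m (- V + - W) =
      - (\<kappa> \<cdot>\<^sub>m X + b \<cdot>\<^sub>m Y + ?c \<cdot>\<^sub>m (W + V))"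
    if "X \<in> carrier_mat N N" "Y \<in> carrier_mat N N" "V \<in> carrier_mat N N" "W \<in> carrier_mat N N"
    for X Y V W :: "real mat"
    using that by (intro eq_matI) (auto simp: algebra_simps)
  have "(\<kappa> \<cdot>\<^sub>m ?D 1 + b \<cdot>\<^sub>m ?D 3 + ?c \<cdot>\<^sub>m (?P * ?D 1 + ?D 1 * ?P))\<^sup>T =
      \<kappa> \<cdot>\<^sub>m - ?D 1 + b \<cdot>\<^sub>m - ?D 3 + ?c \<cdot>\<^sub>m (- (?D 1 * ?P) + - (?P * ?D 1))"
    using carriers
    by (simp add: transpose_add[of _ N N] transpose_smult_mat odd products
        del: One_nat_def)
  also have "\<dots> = - (\<kappa> \<cdot>\<^sub>m ?D 1 + b \<cdot>\<^sub>m ?D 3 + ?c \<cdot>\<^sub>m (?P * ?D 1 + ?D 1 * ?P))"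
    by (rule negation) (use carriers in simp_all)
  finally show ?thesis
    by (simp add: F_op_def transpose_uminus)
qed

section \<open>Quadratic first integrals of Runge-Kutta methods\<close>

lemma scalar_prod_mult_mat_vec_transpose:
  fixes A :: "'a::comm_semiring_0 mat"
  assumes "A \<in> carrier_mat n n" and "u \<in> carrier_vec n" and "v \<in> carrier_vec n"
  shows "u \<bullet> (A *\<^sub>v v) = v \<bullet> (A\<^sup>T *\<^sub>v u)"
  using assms by (metis comm_scalar_prod mult_mat_vec_carrier transpose_carrier_mat
      transpose_vec_mult_scalar)

lemma skew_symmetric_quadratic_form_zero:
  fixes A :: "real mat"
  assumes A: "A \<in> carrier_mat n n" and "A\<^sup>T = - A" and u: "u \<in> carrier_vec n"
  shows "u \<bullet> (A *\<^sub>v u) = 0"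
proof -
  have "u \<bullet> (A *\<^sub>v u) = u \<bullet> (- A *\<^sub>v u)"
    using scalar_prod_mult_mat_vec_transpose[OF A u u] assms by simp
  also have "\<dots> = - (u \<bullet> (A *\<^sub>v u))"
    using A u by simp
  finally show ?thesis by simp
qed

lemma scalar_prod_add_smult_finsum_vec:
  fixes u w :: "real vec"
  assumes "finite S" and "u \<in> carrier_vec n" and "w \<in> carrier_vec n"
    and "\<And>i. i \<in> S \<Longrightarrow> k i \<in> carrier_vec n"
  shows "(u + t \<cdot>\<^sub>v finsum_vec TYPE(real) n (\<lambda>i. c i \<cdot>\<^sub>v k i) S) \<bullet> w =
    u \<bullet> w + t * (\<Sum>i\<in>S. c i * (k i \<bullet> w))"
proof -
  let ?f = "finsum_vec TYPE(real) n (\<lambda>i. c i \<cdot>\<^sub>v k i) S"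
  have f: "?f \<in> carrier_vec n"
    using assms by (auto intro!: finsum_vec_closed)
  have "?f $ j = (\<Sum>i\<in>S. c i * k i $ j)" if "j < n" for j
  proof -
    have "?f $ j = (\<Sum>i\<in>S. (c i \<cdot>\<^sub>v k i) $ j)"
      using assms that by (intro index_finsum_vec) auto
    also have "\<dots> = (\<Sum>i\<in>S. c i * k i $ j)"
      using that by (intro sum.cong) (auto dest!: assms(4))
    finally show ?thesis .
  qed
  then have "?f \<bullet> w = (\<Sum>j<n. \<Sum>i\<in>S. c i * (k i $ j * w $ j))"
    using assms(3) by (simp add: scalar_prod_def lessThan_atLeast0 sum_distrib_right mult.assoc)
  also have "\<dots> = (\<Sum>i\<in>S. c i * (k i \<bullet> w))"
    using assms(3) by (subst sum.swap) (simp add: scalar_prod_def lessThan_atLeast0 sum_distrib_left)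
  finally show ?thesis
    using assms f by (simp add: add_scalar_prod_distrib[of _ n])
qed

text \<open>
  Write \<open>q\<close> for the symmetric bilinear form of \<open>A\<close> and
  \<open>g\<^sub>i\<close> for the \<open>i\<close>-th stage. The new value of the form is
  \<open>q(u, u) + 2 \<tau> \<Sum>\<^sub>i b\<^sub>i q(u, k\<^sub>i) +
  \<tau>\<^sup>2 \<Sum>\<^sub>i\<^sub>j b\<^sub>i b\<^sub>j q(k\<^sub>i, k\<^sub>j)\<close>. The
  orthogonality relations \<open>q(g\<^sub>i, k\<^sub>i) = 0\<close> express each \<open>q(u, k\<^sub>i)\<close>
  through the \<open>q(k\<^sub>i, k\<^sub>j)\<close>. Since \<open>q\<close> is symmetric, only the
  symmetric part of the resulting coefficients \<open>b\<^sub>i a\<^sub>i\<^sub>j\<close> matters, and it is prescribed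
  by the hypothesis on them.
\<close>

lemma Runge_Kutta_conserves_quadratic_form:
  fixes A :: "real mat" and a :: "'i \<Rightarrow> 'i \<Rightarrow> real" and bw :: "'i \<Rightarrow> real"
  assumes S: "finite S"
    and A: "A \<in> carrier_mat n n" and sym: "A\<^sup>T = A"
    and u: "u \<in> carrier_vec n" and k: "\<And>i. i \<in> S \<Longrightarrow> k i \<in> carrier_vec n"
    and cooper: "\<And>i j. i \<in> S \<Longrightarrow> j \<in> S \<Longrightarrow> bw i * a i j + bw j * a j i = bw i * bw j"
    and orth: "\<And>i. i \<in> S \<Longrightarrow>
      (u + \<tau> \<cdot>\<^sub>v finsum_vec TYPE(real) n (\<lambda>j. a i j \<cdot>\<^sub>v k j) S) \<bullet> (A *\<^sub>v k i) = 0"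
    and v_def: "v = u + \<tau> \<cdot>\<^sub>v finsum_vec TYPE(real) n (\<lambda>i. bw i \<cdot>\<^sub>v k i) S"
  shows "v \<bullet> (A *\<^sub>v v) = u \<bullet> (A *\<^sub>v u)"
proof -
  define q where "q x y = x \<bullet> (A *\<^sub>v y)" for x y
  have q_sym: "q x y = q y x" if "x \<in> carrier_vec n" "y \<in> carrier_vec n" for x y
    using scalar_prod_mult_mat_vec_transpose[OF A that] by (simp add: q_def sym)
  have q_step: "q (u + \<tau> \<cdot>\<^sub>v finsum_vec TYPE(real) n (\<lambda>i. c i \<cdot>\<^sub>v k i) S) y =
      q u y + \<tau> * (\<Sum>i\<in>S. c i * q (k i) y)" if "y \<in> carrier_vec n" for c y
    unfolding q_def using S A u k that by (intro scalar_prod_add_smult_finsum_vec) auto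
  have v: "v \<in> carrier_vec n"
    unfolding v_def using u k by (auto intro!: add_carrier_vec finsum_vec_closed)
  let ?L = "\<Sum>i\<in>S. bw i * q u (k i)"
  let ?Q = "\<Sum>i\<in>S. \<Sum>j\<in>S. bw i * bw j * q (k i) (k j)"
  let ?R = "\<Sum>i\<in>S. \<Sum>j\<in>S. bw i * a i j * q (k i) (k j)"
  have stage: "q u (k i) = - \<tau> * (\<Sum>j\<in>S. a i j * q (k i) (k j))" if i: "i \<in> S" for i
  proof -
    have "(\<Sum>j\<in>S. a i j * q (k j) (k i)) = (\<Sum>j\<in>S. a i j * q (k i) (k j))"
      using k i by (intro sum.cong) (auto simp: q_sym)
    then show ?thesis
      using orth[OF i] q_step[OF k[OF i], of "a i"] by (simp add: q_def)
  qed
  have linear_part: "?L = - \<tau> * ?R"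
    by (simp add: stage sum_distrib_left mult_ac)
  have quadratic_part: "?Q = 2 * ?R"
  proof -
    have "?R = (\<Sum>i\<in>S. \<Sum>j\<in>S. bw j * a j i * q (k i) (k j))"
      by (subst sum.swap) (intro sum.cong refl, simp add: q_sym k)
    then have "2 * ?R =
        (\<Sum>i\<in>S. \<Sum>j\<in>S. (bw i * a i j + bw j * a j i) * q (k i) (k j))"
      by (simp add: distrib_right sum.distrib)
    then show ?thesis
      by (simp add: cooper)
  qed
  have "q u v = q u u + \<tau> * ?L"
    using q_sym[OF u v] q_step[OF u, of bw] by (simp add: v_def q_sym u k)
  moreover have "(\<Sum>i\<in>S. bw i * q (k i) v) = ?L + \<tau> * ?Q"
  proof -
    have "q (k i) v = q u (k i) + \<tau> * (\<Sum>j\<in>S. bw j * q (k i) (k j))" if i: "i \<in> S" for i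
      using q_sym[OF k[OF i] v] q_step[OF k[OF i], of bw] by (simp add: v_def q_sym k i)
    then show ?thesis
      by (simp add: distrib_left sum.distrib sum_distrib_left mult_ac)
  qed
  moreover have "q v v = q u v + \<tau> * (\<Sum>i\<in>S. bw i * q (k i) v)"
    using q_step[OF v, of bw] by (simp add: v_def)
  ultimately have "q v v = q u u + 2 * \<tau> * ?L + \<tau>\<^sup>2 * ?Q"
    by (simp add: algebra_simps power2_eq_square)
  then show ?thesis
    by (simp add: q_def[symmetric] linear_part quadratic_part power2_eq_square)
qed

section \<open>Conservation of the discrete momentum\<close>

lemma momentum_eq_quadratic_form:
  assumes "U \<in> carrier_vec N"
  shows "momentum xl xr N \<delta> \<alpha> U =
    1 / 2 * mesh xl xr N * (U \<bullet> (A_op xl xr N \<delta> \<alpha> *\<^sub>v U))"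
  using carrier_matD[OF A_op_carrier, of xl xr N \<delta> \<alpha>]
  by (simp add: momentum_def inner_h_def scalar_prod_def lessThan_atLeast0)

theorem theorem2p3:
  fixes \<kappa> b \<beta> \<delta> \<alpha> xl xr \<tau> :: real
    and p N s :: nat
    and bw :: "nat \<Rightarrow> real"
    and a :: "nat \<Rightarrow> nat \<Rightarrow> real"
    and U :: "nat \<Rightarrow> real vec"
    and K Us :: "nat \<Rightarrow> nat \<Rightarrow> real vec"
  assumes "\<delta> > 0" and "\<alpha> > 0" and "p \<ge> 1"
    and "xl < xr" and "N > 0" and "even N"
    and "s \<ge> 1"
    and "\<forall>i\<in>{1..s}. \<forall>j\<in>{1..s}. bw i * a i j + bw j * a j i = bw i * bw j"
    and "\<tau> > 0"
    and "\<forall>n. U n \<in> carrier_vec N"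
    and "\<forall>n. \<forall>i\<in>{1..s}. K n i \<in> carrier_vec N \<and> Us n i \<in> carrier_vec N"
    and "\<forall>n. \<forall>i\<in>{1..s}. A_op xl xr N \<delta> \<alpha> *\<^sub>v K n i = F_op xl xr N \<kappa> b \<beta> p (Us n i) *\<^sub>v Us n i"
    and "\<forall>n. \<forall>i\<in>{1..s}.
      Us n i = U n + \<tau> \<cdot>\<^sub>v finsum_vec TYPE(real) N (\<lambda>j. a i j \<cdot>\<^sub>v K n j) {1..s}"
    and "\<forall>n. U (Suc n) = U n + \<tau> \<cdot>\<^sub>v finsum_vec TYPE(real) N (\<lambda>i. bw i \<cdot>\<^sub>v K n i) {1..s}"
  shows "\<forall>n. momentum xl xr N \<delta> \<alpha> (U (Suc n)) = momentum xl xr N \<delta> \<alpha> (U n)"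
proof
  fix n
  let ?A = "A_op xl xr N \<delta> \<alpha>"
  have "U (Suc n) \<bullet> (?A *\<^sub>v U (Suc n)) = U n \<bullet> (?A *\<^sub>v U n)"
  proof (rule Runge_Kutta_conserves_quadratic_form[where S = "{1..s}" and n = N
        and k = "K n" and a = a and bw = bw and \<tau> = \<tau>])
    fix i
    assume i: "i \<in> {1..s}"
    have "Us n i \<bullet> (?A *\<^sub>v K n i) = Us n i \<bullet> (F_op xl xr N \<kappa> b \<beta> p (Us n i) *\<^sub>v Us n i)"
      using assms(12) i by simp
    also have "\<dots> = 0"
      using assms(11) i by (intro skew_symmetric_quadratic_form_zero[of _ N] F_op_skew_symmetric) auto
    finally show "(U n + \<tau> \<cdot>\<^sub>v finsum_vec TYPE(real) N (\<lambda>j. a i j \<cdot>\<^sub>v K n j) {1..s}) \<bullet>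
        (?A *\<^sub>v K n i) = 0"
      using assms(13) i by metis
  qed (use assms in \<open>auto simp: A_op_symmetric\<close>)
  then show "momentum xl xr N \<delta> \<alpha> (U (Suc n)) = momentum xl xr N \<delta> \<alpha> (U n)"
    using assms(10) by (simp add: momentum_eq_quadratic_form)
qed

end
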